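(* Let $\alpha\in(0,1]$ and $t_0<t^*$. Let $a:[t_0,t^* )\to\mathbb{R}_+$ be nondecreasing and $f:[t_0,t^* )\to\mathbb{R}_+$ be continuous. Assume that $u:[t_0,t^* )\to\mathbb{R}_+$ satisfies $$u(t)\le a(t)+\int_{t_0}^t|s|^{\alpha-1}f(s)u(s)\,ds,\qquad t\in[t_0,t^* ).$$ Then for all $t\in[t_0,t^* )$ $$u(t)\le a(t)\exp\Big(\int_{t_0}^t|s|^{\alpha-1}f(s)\,ds\Big)\le a(t)\,E_\alpha\Big(\sup_{s\in[t_0,t]}f(s),|t|\Big)E_\alpha\Big(\sup_{s\in[t_0,t]}f(s),|t_0|\Big).$$
   Context: $\mathbb{R}_+=[0,\infty)$. $E_\alpha(\lambda,t):=\exp(\lambda t^\alpha/\alpha)$ for $\lambda\in\mathbb{R}$, $t\ge0$. The integral in the hypothesis is assumed to be well defined (e.g. $u$ measurable with $|s|^{\alpha-1}f(s)u(s)$ integrable on $[t_0,t]$ for each $t$). *)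

theory Defs
  imports "HOL-Analysis.Analysis"
begin

text \<open>
  Used for \<open>t \<ge> 0\<close> and \<open>\<alpha> > 0\<close>, where \<open>powr\<close> is the usual
  real power, including \<open>0 powr \<alpha> = 0\<close>.
\<close>
definition E_alpha :: "real \<Rightarrow> real \<Rightarrow> real \<Rightarrow> real" where
  "E_alpha \<alpha> c t = exp (c * t powr \<alpha> / \<alpha>)"

text \<open>
  In Isabelle \<open>0 powr x = 0\<close> for every \<open>x\<close>, so this weight has the value \<open>0\<close> at \<open>s = 0\<close>,
  where the classical \<open>\<bar>s\<bar>\<^sup>\<alpha>\<^sup>-\<^sup>1\<close> is infinite (\<open>\<alpha> < 1\<close>) or \<open>1\<close> (\<open>\<alpha> = 1\<close>).
  It only occurs under a Lebesgue integral, where the value at a single point is irrelevant.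
\<close>
definition frac_weight :: "real \<Rightarrow> real \<Rightarrow> real" where
  "frac_weight \<alpha> s = \<bar>s\<bar> powr (\<alpha> - 1)"

end

theory Submission
  imports Defs
begin

text \<open>
  Fix the endpoint \<open>T\<close> and put \<open>V t = a T + \<integral> k u\<close> over \<open>[t0, t]\<close>, where \<open>k s = \<bar>s\<bar> powr (\<alpha> - 1) * f s\<close>.
  Since \<open>u \<le> V\<close> and \<open>V\<close> is nondecreasing, \<open>V t - V s \<le> V t * (K t - K s)\<close>, where \<open>K\<close> is the
  indefinite integral of \<open>k\<close>. Applying this along a partition that cuts the range of the
  continuous function \<open>K\<close> into \<open>n\<close> equal parts gives \<open>V T * (1 - K T / n) ^ n \<le> a T\<close>, and
  \<open>n \<rightarrow> \<infinity>\<close> yields the first inequality without differentiating \<open>V\<close>.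
  The second one bounds \<open>f\<close> by its supremum and integrates the weight exactly.
\<close>

lemma discrete_gronwall_exp_bound:
  fixes V K :: "real \<Rightarrow> real"
  assumes "c \<le> d" and cont: "continuous_on {c..d} K"
    and monoK: "mono_on {c..d} K"
    and step: "\<And>s t. c \<le> s \<Longrightarrow> s \<le> t \<Longrightarrow> t \<le> d \<Longrightarrow> V t * (1 - (K t - K s)) \<le> V s"
  shows "V d \<le> V c * exp (K d - K c)"
proof -
  define x where "x = K d - K c"
  have x0: "0 \<le> x"
    unfolding x_def using mono_onD[OF monoK, of c d] \<open>c \<le> d\<close> by simp
  \<comment> \<open>The condition \<open>real n > x\<close> makes the factor
    \<open>1 - x / real n\<close> positive, so multiplying an inequality by its powers keeps the
    direction. All large \<open>n\<close> satisfy it, which is enough for the limit.\<close>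
  have bound: "V d * (1 - x / real n) ^ n \<le> V c" if n: "real n > x" for n
  proof -
    have npos: "0 < real n" using n x0 by linarith
    have q0: "0 \<le> 1 - x / real n" using n npos by (simp add: field_simps)
    \<comment> \<open>\<open>K\<close> may be constant on intervals, so a level need not determine a
      point. The claim therefore covers every \<open>t\<close> on level \<open>i\<close>, and the
      induction can use whichever point the intermediate value theorem returns. The endpoint
      \<open>d\<close> lies on level \<open>n\<close>.\<close>
    have main: "\<forall>t\<in>{c..d}. K t = K c + real i * (x / real n) \<longrightarrow> V t * (1 - x / real n) ^ i \<le> V c"
      if "i \<le> n" for i
      using that
    proof (induction i)
      case 0
      \<comment> \<open>On level \<open>0\<close> the increment \<open>K t - K c\<close> vanishes,
        so \<open>step\<close> reads \<open>V t \<le> V c\<close>.\<close>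
      show ?case using step[of c] by fastforce
    next
      case (Suc i)
      show ?case
      proof (intro ballI impI)
        fix t assume t: "t \<in> {c..d}" and Kt: "K t = K c + real (Suc i) * (x / real n)"
        have "K c \<le> K c + real i * (x / real n)" "K c + real i * (x / real n) \<le> K t"
          using x0 npos unfolding Kt by (auto intro!: divide_right_mono mult_right_mono)
        moreover have "continuous_on {c..t} K"
          using cont t by (auto intro: continuous_on_subset)
        ultimately obtain s where s: "c \<le> s" "s \<le> t" "K s = K c + real i * (x / real n)"
          using IVT'[of K c "K c + real i * (x / real n)" t] t by auto
        have "K t - K s = x / real n" using Kt s by (simp add: algebra_simps add_divide_distrib)
        then have "V t * (1 - x / real n) \<le> V s" using step[of s t] s t by auto
        then have "V t * (1 - x / real n) * (1 - x / real n) ^ i \<le> V s * (1 - x / real n) ^ i"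
          using q0 by (intro mult_right_mono) auto
        also have "\<dots> \<le> V c" using Suc s t by auto
        finally show "V t * (1 - x / real n) ^ Suc i \<le> V c" by (simp add: mult.assoc)
      qed
    qed
    show ?thesis using main[of n] npos \<open>c \<le> d\<close> by (auto simp: x_def)
  qed
  \<comment> \<open>Writing \<open>1 - x / real n\<close> as \<open>1 + (- x) / real n\<close>
    matches the standard limit for \<open>exp (- x)\<close>.\<close>
  have "(\<lambda>n. V d * (1 + (- x) / real n) ^ n) \<longlonglongrightarrow> V d * exp (- x)"
    by (intro tendsto_intros tendsto_exp_limit_sequentially)
  moreover have "eventually (\<lambda>n. V d * (1 + (- x) / real n) ^ n \<le> V c) sequentially"
    using bound filterlim_real_sequentially
    by (auto simp: filterlim_at_top_dense elim!: allE[of _ x] eventually_mono)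
  ultimately have "V d * exp (- x) \<le> V c"
    by (rule tendsto_upperbound) simp
  then have "V d * exp (- x) * exp x \<le> V c * exp x" by (intro mult_right_mono) auto
  then show ?thesis by (simp add: x_def mult.assoc flip: exp_add)
qed

text \<open>Integrability of \<open>k\<close> alone makes its indefinite integral continuous, so the
  partition argument also covers kernels with a singularity. The additive term is a constant
  \<open>A\<close>, to be instantiated with the value of \<open>a\<close> at the right
  endpoint.\<close>

lemma gronwall_lebesgue_kernel:
  fixes k u :: "real \<Rightarrow> real"
  assumes "c \<le> d" and k: "k absolutely_integrable_on {c..d}"
    and ku: "(\<lambda>s. k s * u s) absolutely_integrable_on {c..d}"
    and k0: "\<And>s. s \<in> {c..d} \<Longrightarrow> 0 \<le> k s" and u0: "\<And>s. s \<in> {c..d} \<Longrightarrow> 0 \<le> u s"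
    and le: "\<And>t. t \<in> {c..d} \<Longrightarrow> u t \<le> A + integral {c..t} (\<lambda>s. k s * u s)"
  shows "u d \<le> A * exp (integral {c..d} k)"
proof -
  define V where "V t = A + integral {c..t} (\<lambda>s. k s * u s)" for t
  define K where "K t = integral {c..t} k" for t
  have ki: "k integrable_on {c..d}" and kui: "(\<lambda>s. k s * u s) integrable_on {c..d}"
    using k ku by (auto simp: set_lebesgue_integral_eq_integral)
  have sub: "k integrable_on {s..t}" "(\<lambda>s. k s * u s) integrable_on {s..t}"
    if "c \<le> s" "t \<le> d" for s t
    using that integrable_on_subinterval[OF ki] integrable_on_subinterval[OF kui] by auto
  have Kdiff: "K t - K s = integral {s..t} k"
    and Vdiff: "V t - V s = integral {s..t} (\<lambda>s. k s * u s)"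
    if "c \<le> s" "s \<le> t" "t \<le> d" for s t
    using Henstock_Kurzweil_Integration.integral_combine[OF that(1,2) sub(1)[of c t]]
      Henstock_Kurzweil_Integration.integral_combine[OF that(1,2) sub(2)[of c t]] that
    by (auto simp: K_def V_def)
  have monoK: "K s \<le> K t" and monoV: "V s \<le> V t" if "c \<le> s" "s \<le> t" "t \<le> d" for s t
  proof -
    have "0 \<le> integral {s..t} k"
      using that k0 by (intro Henstock_Kurzweil_Integration.integral_nonneg sub) auto
    then show "K s \<le> K t" using Kdiff[OF that] by simp
    have "0 \<le> integral {s..t} (\<lambda>s. k s * u s)"
      using that k0 u0 by (intro Henstock_Kurzweil_Integration.integral_nonneg sub) auto
    then show "V s \<le> V t" using Vdiff[OF that] by simp
  qed
  have "V d \<le> V c * exp (K d - K c)"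
  proof (rule discrete_gronwall_exp_bound[OF \<open>c \<le> d\<close>])
    show "continuous_on {c..d} K"
      unfolding K_def by (rule indefinite_integral_continuous_1[OF ki])
    show "mono_on {c..d} K" using monoK by (auto intro!: mono_onI)
    fix s t assume st: "c \<le> s" "s \<le> t" "t \<le> d"
    have "integral {s..t} (\<lambda>r. k r * u r) \<le> integral {s..t} (\<lambda>r. k r * V t)"
    proof (rule integral_le)
      fix r assume r: "r \<in> {s..t}"
      have "u r \<le> V r" using le[of r] r st by (simp add: V_def)
      also have "\<dots> \<le> V t" using monoV[of r t] r st by simp
      finally show "k r * u r \<le> k r * V t" using k0[of r] r st by (intro mult_left_mono) auto
    qed (use sub st in \<open>auto intro: integrable_on_mult_left\<close>)
    then have "V t - V s \<le> (K t - K s) * V t"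
      using Vdiff[OF st] Kdiff[OF st] by simp
    then show "V t * (1 - (K t - K s)) \<le> V s" by (simp add: algebra_simps)
  qed
  moreover have "u d \<le> V d" using le[of d] \<open>c \<le> d\<close> by (simp add: V_def)
  ultimately show ?thesis by (simp add: V_def K_def)
qed

text \<open>The odd function \<open>sgn s * \<bar>s\<bar> powr \<alpha> / \<alpha>\<close> is an
  antiderivative away from \<open>0\<close> and stays continuous at \<open>0\<close> because
  \<alpha> > 0. The fundamental theorem with the exceptional set \<open>{0}\<close> then covers
  intervals that contain the singularity.\<close>

lemma has_integral_abs_powr:
  fixes \<alpha> c d :: real
  assumes "0 < \<alpha>" "c \<le> d"
  shows "((\<lambda>s. \<bar>s\<bar> powr (\<alpha> - 1)) has_integral
           (sgn d * \<bar>d\<bar> powr \<alpha> / \<alpha> - sgn c * \<bar>c\<bar> powr \<alpha> / \<alpha>)) {c..d}"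
proof (rule fundamental_theorem_of_calculus_interior_strong[of "{0}"])
  let ?G = "\<lambda>s::real. sgn s * \<bar>s\<bar> powr \<alpha> / \<alpha>"
  show "continuous_on {c..d} ?G"
  proof -
    \<comment> \<open>Splitting \<open>?G\<close> this way avoids the discontinuity of \<open>sgn\<close> at \<open>0\<close>.\<close>
    have "?G = (\<lambda>s. (max s 0 powr \<alpha> - max (- s) 0 powr \<alpha>) / \<alpha>)"
      by (auto simp: fun_eq_iff max_def sgn_if)
    moreover have "continuous_on {c..d} \<dots>"
      using assms by (intro continuous_intros continuous_on_powr') auto
    ultimately show ?thesis by (simp only:)
  qed
  fix s assume s: "s \<in> {c<..<d} - {0}"
  show "(?G has_vector_derivative \<bar>s\<bar> powr (\<alpha> - 1)) (at s)"
    unfolding has_real_derivative_iff_has_vector_derivative[symmetric]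
  proof (cases "0 < s")
    case True
    have "((\<lambda>s. s powr \<alpha> / \<alpha>) has_real_derivative \<bar>s\<bar> powr (\<alpha> - 1)) (at s)"
      using True assms by (auto intro!: derivative_eq_intros)
    \<comment> \<open>On each open half-line \<open>sgn\<close> is constant, so \<open>?G\<close>
      agrees there with a plain power and inherits its derivative.\<close>
    then show "(?G has_real_derivative \<bar>s\<bar> powr (\<alpha> - 1)) (at s)"
      by (rule has_field_derivative_transform_within_open[where S = "{0<..}"]) (use True in auto)
  next
    case False
    then have "s < 0" using s by auto
    have "((\<lambda>s. - ((- s) powr \<alpha>) / \<alpha>) has_real_derivative \<bar>s\<bar> powr (\<alpha> - 1)) (at s)"
      using \<open>s < 0\<close> assms by (auto intro!: derivative_eq_intros)
    then show "(?G has_real_derivative \<bar>s\<bar> powr (\<alpha> - 1)) (at s)"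
      by (rule has_field_derivative_transform_within_open[where S = "{..<0}"])
        (use \<open>s < 0\<close> in auto)
  qed
qed (use assms in auto)

text \<open>Replacing both signed endpoint terms by their absolute values gives equality when
  \<open>c \<le> 0 \<le> d\<close> and an overestimate otherwise. This form yields one
  \<open>E_alpha\<close> factor per endpoint.\<close>

lemma
  assumes "0 < \<alpha>" "c \<le> d"
  shows frac_weight_absolutely_integrable: "frac_weight \<alpha> absolutely_integrable_on {c..d}"
    and frac_weight_integral_le: "integral {c..d} (frac_weight \<alpha>) \<le> \<bar>d\<bar> powr \<alpha> / \<alpha> + \<bar>c\<bar> powr \<alpha> / \<alpha>"
proof -
  note I = has_integral_abs_powr[OF assms, folded frac_weight_def]
  have "frac_weight \<alpha> integrable_on {c..d}"
    using I by (auto simp: integrable_on_def)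
  then show "frac_weight \<alpha> absolutely_integrable_on {c..d}"
    by (rule nonnegative_absolutely_integrable_1) (simp add: frac_weight_def)
  have "sgn x * \<bar>x\<bar> powr \<alpha> / \<alpha> \<le> \<bar>x\<bar> powr \<alpha> / \<alpha>"
    "- (sgn x * \<bar>x\<bar> powr \<alpha> / \<alpha>) \<le> \<bar>x\<bar> powr \<alpha> / \<alpha>" for x :: real
    using assms by (auto simp: sgn_if field_simps)
  note b = this(1)[of d] this(2)[of c]
  show "integral {c..d} (frac_weight \<alpha>) \<le> \<bar>d\<bar> powr \<alpha> / \<alpha> + \<bar>c\<bar> powr \<alpha> / \<alpha>"
    using integral_unique[OF I] b by simp
qed

lemma frac_weight_mult_absolutely_integrable:
  fixes f :: "real \<Rightarrow> real"
  assumes "0 < \<alpha>" "c \<le> d" and f: "continuous_on {c..d} f"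
  shows "(\<lambda>s. frac_weight \<alpha> s * f s) absolutely_integrable_on {c..d}"
proof -
  have "(\<lambda>s. f s * frac_weight \<alpha> s) absolutely_integrable_on {c..d}"
    using f frac_weight_absolutely_integrable[OF assms(1,2)]
    by (intro absolutely_integrable_bounded_measurable_product_real
          continuous_imp_measurable_on_sets_lebesgue compact_imp_bounded compact_continuous_image)
       auto
  then show ?thesis by (simp add: mult.commute)
qed

theorem lemma2p1:
  fixes \<alpha> t0 tstar :: real and a f u :: "real \<Rightarrow> real"
  assumes "0 < \<alpha>" and "\<alpha> \<le> 1" and "t0 < tstar"
    and "a \<in> {t0..<tstar} \<rightarrow> {0..}" and "mono_on {t0..<tstar} a"
    and "f \<in> {t0..<tstar} \<rightarrow> {0..}" and "continuous_on {t0..<tstar} f"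
    and "u \<in> {t0..<tstar} \<rightarrow> {0..}"
    and "\<And>t. t \<in> {t0..<tstar} \<Longrightarrow>
           set_integrable lebesgue {t0..t} (\<lambda>s. frac_weight \<alpha> s * f s * u s)"
    and "\<And>t. t \<in> {t0..<tstar} \<Longrightarrow>
           u t \<le> a t + (LINT s:{t0..t}|lebesgue. frac_weight \<alpha> s * f s * u s)"
  shows "\<forall>t\<in>{t0..<tstar}.
      u t \<le> a t * exp (LINT s:{t0..t}|lebesgue. frac_weight \<alpha> s * f s) \<and>
      a t * exp (LINT s:{t0..t}|lebesgue. frac_weight \<alpha> s * f s)
        \<le> a t * E_alpha \<alpha> (SUP s\<in>{t0..t}. f s) \<bar>t\<bar>
              * E_alpha \<alpha> (SUP s\<in>{t0..t}. f s) \<bar>t0\<bar>"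
proof
  fix T assume T: "T \<in> {t0..<tstar}"
  then have T0: "t0 \<le> T" and sub: "{t0..T} \<subseteq> {t0..<tstar}" by auto
  define k where "k s = frac_weight \<alpha> s * f s" for s
  define S where "S = (SUP s\<in>{t0..T}. f s)"
  have w0: "0 \<le> frac_weight \<alpha> s" for s by (simp add: frac_weight_def)
  have f0: "0 \<le> f s" if "s \<in> {t0..T}" for s using assms(6) sub that by auto
  have u0: "0 \<le> u s" if "s \<in> {t0..T}" for s using assms(8) sub that by auto
  have fc: "continuous_on {t0..T} f" using assms(7) sub by (rule continuous_on_subset)
  have k: "k absolutely_integrable_on {t0..T}"
    unfolding k_def by (rule frac_weight_mult_absolutely_integrable[OF assms(1) T0 fc])
  \<comment> \<open>This passes from the Lebesgue integral of the statement to the gauge integral of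
    the lemmas.\<close>
  have k_eq: "(LINT s:{t0..T}|lebesgue. frac_weight \<alpha> s * f s) = integral {t0..T} k"
    using set_lebesgue_integral_eq_integral(2)[OF k] by (simp add: k_def)
  have "u T \<le> a T * exp (integral {t0..T} k)"
  proof (rule gronwall_lebesgue_kernel[OF T0 k])
    show "(\<lambda>s. k s * u s) absolutely_integrable_on {t0..T}"
      using assms(9)[OF T] by (simp add: k_def)
    fix t assume t: "t \<in> {t0..T}"
    then have t': "t \<in> {t0..<tstar}" using sub by auto
    show "0 \<le> k t" "0 \<le> u t" using w0 f0 u0 t by (auto simp: k_def)
    \<comment> \<open>Monotonicity freezes \<open>a\<close> at the endpoint, which supplies the
      constant \<open>A\<close>.\<close>
    have "a t \<le> a T" using mono_onD[OF assms(5) t' T] t by simp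
    then show "u t \<le> a T + integral {t0..t} (\<lambda>s. k s * u s)"
      using assms(10)[OF t'] set_lebesgue_integral_eq_integral(2)[OF assms(9)[OF t']]
      by (simp add: k_def)
  qed
  moreover have "a T * exp (integral {t0..T} k)
      \<le> a T * E_alpha \<alpha> S \<bar>T\<bar> * E_alpha \<alpha> S \<bar>t0\<bar>"
  proof -
    \<comment> \<open>The supremum in the reals bounds \<open>f\<close> only once the image is known
      to be bounded above; compactness of \<open>{t0..T}\<close> gives this.\<close>
    have fS: "f s \<le> S" if "s \<in> {t0..T}" for s
      unfolding S_def using that compact_continuous_image[OF fc]
      by (intro cSUP_upper bounded_imp_bdd_above compact_imp_bounded) auto
    have S0: "0 \<le> S" using f0[of t0] fS[of t0] T0 by auto
    note w = frac_weight_absolutely_integrable[OF assms(1) T0] frac_weight_integral_le[OF assms(1) T0]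
    have wi: "frac_weight \<alpha> integrable_on {t0..T}" and ki: "k integrable_on {t0..T}"
      using w(1) k by (auto simp: set_lebesgue_integral_eq_integral)
    have "integral {t0..T} k \<le> integral {t0..T} (\<lambda>s. frac_weight \<alpha> s * S)"
      using ki wi fS w0
      by (intro integral_le) (auto simp: k_def intro: mult_left_mono integrable_on_mult_left)
    also have "\<dots> = S * integral {t0..T} (frac_weight \<alpha>)" by simp
    also have "\<dots> \<le> S * (\<bar>T\<bar> powr \<alpha> / \<alpha> + \<bar>t0\<bar> powr \<alpha> / \<alpha>)"
      using w(2) S0 by (rule mult_left_mono)
    finally have "exp (integral {t0..T} k) \<le> E_alpha \<alpha> S \<bar>T\<bar> * E_alpha \<alpha> S \<bar>t0\<bar>"
      by (simp add: E_alpha_def algebra_simps flip: exp_add)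
    moreover have "0 \<le> a T" using assms(4) T by auto
    ultimately show ?thesis by (simp add: mult.assoc mult_left_mono)
  qed
  ultimately show "u T \<le> a T * exp (LINT s:{t0..T}|lebesgue. frac_weight \<alpha> s * f s) \<and>
      a T * exp (LINT s:{t0..T}|lebesgue. frac_weight \<alpha> s * f s)
        \<le> a T * E_alpha \<alpha> (SUP s\<in>{t0..T}. f s) \<bar>T\<bar>
              * E_alpha \<alpha> (SUP s\<in>{t0..T}. f s) \<bar>t0\<bar>"
    unfolding k_eq S_def by blast
qed

end
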